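(* Let $T$ be a minimal $m$-IET defined by a separating permutation. If $T$ has an $n^{th}$ root in $\mathbb{G}$ for some $n\geq 2$, then $\operatorname{rank}(T)\leq 1+\lfloor m/2\rfloor$.
   Context: Interval exchange transformations (IETs): fix $m\in\mathbb{N}$, $m\ge 1$, a permutation $\pi\in S_m$ of $\{1,\dots,m\}$, and $\lambda=(\lambda_1,\dots,\lambda_m)$ with $\lambda_i>0$ and $\sum_i\lambda_i=1$. Put $\beta_0=0$, $\beta_j=\lambda_1+\cdots+\lambda_j$, and $I_j=[\beta_{j-1},\beta_j)$ for $1\le j\le m$. The $m$-IET $T_{(\pi,\lambda)}:[0,1)\to[0,1)$ (defined by $\pi$) is the bijection given by $T_{(\pi,\lambda)}(x)=x-\sum_{i<j}\lambda_i+\sum_{\pi(i)<\pi(j)}\lambda_i$ for $x\in I_j$. The set of all IETs forms a group $\mathbb{G}$ under composition. $T$ is minimal if every orbit $\{T^k(x):k\in\mathbb{Z}\}$ is dense in $[0,1)$. $T$ has an $n^{th}$ root in $\mathbb{G}$ if there is $S\in\mathbb{G}$ with $T=S^n$ ($n$-fold composition). A permutation $\pi\in S_m$ is separating if $\pi(i+1)\ne\pi(i)+1$ for $1\le i\le m-1$. Rank: if $\gamma_1<\cdots<\gamma_{r-1}$ are the points at which an IET $T$ is discontinuous, $\gamma_0=0$, $\gamma_r=1$, and $l_j=\gamma_j-\gamma_{j-1}$ for $1\le j\le r$, then $\operatorname{rank}(T)$ is the dimension of the $\mathbb{Q}$-vector space spanned by $l_1,\dots,l_r$. *)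

theory Defs
  imports "HOL-Analysis.Analysis" "HOL-Combinatorics.Permutations"
begin

definition iet_data :: "nat \<Rightarrow> (nat \<Rightarrow> nat) \<Rightarrow> (nat \<Rightarrow> real) \<Rightarrow> bool" where
  "iet_data m \<pi> lam \<longleftrightarrow> 1 \<le> m \<and> \<pi> permutes {1..m} \<and>
     (\<forall>i\<in>{1..m}. 0 < lam i) \<and> (\<Sum>i=1..m. lam i) = 1"

definition iet_beta :: "(nat \<Rightarrow> real) \<Rightarrow> nat \<Rightarrow> real" where
  "iet_beta lam j = (\<Sum>i=1..j. lam i)"

definition iet_interval :: "(nat \<Rightarrow> real) \<Rightarrow> nat \<Rightarrow> real set" where
  "iet_interval lam j = {iet_beta lam (j - 1)..<iet_beta lam j}"

text \<open>
  A self-map of \<open>[0,1)\<close> is represented by its extension to the reals by the identity. Thus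
  equality, composition, iteration and inversion of interval exchange transformations are those
  of functions on the reals.
\<close>

definition iet :: "nat \<Rightarrow> (nat \<Rightarrow> nat) \<Rightarrow> (nat \<Rightarrow> real) \<Rightarrow> real \<Rightarrow> real" where
  "iet m \<pi> lam x =
     (if x \<in> {0..<1} then
        (let j = (THE j. j \<in> {1..m} \<and> x \<in> iet_interval lam j)
         in x - (\<Sum>i | i \<in> {1..m} \<and> i < j. lam i) + (\<Sum>i | i \<in> {1..m} \<and> \<pi> i < \<pi> j. lam i))
      else x)"

definition IETs :: "(real \<Rightarrow> real) set" where
  "IETs = {iet m \<pi> lam | m \<pi> lam. iet_data m \<pi> lam}"

definition has_iet_root :: "nat \<Rightarrow> (real \<Rightarrow> real) \<Rightarrow> bool" where
  "has_iet_root n T \<longleftrightarrow> (\<exists>S\<in>IETs. T = S ^^ n)"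

definition int_iterate :: "('a \<Rightarrow> 'a) \<Rightarrow> int \<Rightarrow> 'a \<Rightarrow> 'a" where
  "int_iterate T k = (if 0 \<le> k then T ^^ nat k else inv T ^^ nat (- k))"

definition minimal_iet :: "(real \<Rightarrow> real) \<Rightarrow> bool" where
  "minimal_iet T \<longleftrightarrow> (\<forall>x\<in>{0..<1}. {0..<1} \<subseteq> closure {int_iterate T k x | k. True})"

definition separating :: "nat \<Rightarrow> (nat \<Rightarrow> nat) \<Rightarrow> bool" where
  "separating m \<pi> \<longleftrightarrow> (\<forall>i. 1 \<le> i \<and> i \<le> m - 1 \<longrightarrow> \<pi> (i + 1) \<noteq> \<pi> i + 1)"

text \<open>
  Discontinuity is that of a map on the space \<open>[0,1)\<close>, so that the endpoint \<open>0\<close>, where an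
  interval exchange transformation is continuous from the right, is not a discontinuity.
\<close>

definition discontinuities :: "(real \<Rightarrow> real) \<Rightarrow> real set" where
  "discontinuities T = {x \<in> {0..<1}. \<not> continuous (at x within {0..<1}) T}"

text \<open>The list \<open>\<gamma>\<^sub>0 < \<gamma>\<^sub>1 < \<dots> < \<gamma>\<^sub>r\<close>, including \<open>\<gamma>\<^sub>0 = 0\<close> and \<open>\<gamma>\<^sub>r = 1\<close>.\<close>

definition break_points :: "(real \<Rightarrow> real) \<Rightarrow> real list" where
  "break_points T = sorted_list_of_set ({0, 1} \<union> discontinuities T)"

definition gap_lengths :: "(real \<Rightarrow> real) \<Rightarrow> real set" where
  "gap_lengths T =
     {break_points T ! j - break_points T ! (j - 1) | j. 1 \<le> j \<and> j < length (break_points T)}"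

definition rat_scale :: "rat \<Rightarrow> real \<Rightarrow> real" where
  "rat_scale q x = of_rat q * x"

interpretation rat_real: vector_space rat_scale
  by unfold_locales (simp_all add: rat_scale_def of_rat_add of_rat_mult algebra_simps)

definition iet_rank :: "(real \<Rightarrow> real) \<Rightarrow> nat" where
  "iet_rank T = rat_real.dim (rat_real.span (gap_lengths T))"

end

theory Submission
  imports Defs
begin

text \<open>
  Let \<open>T = S\<^sup>n\<close> and let \<open>p\<close> be the number of \<open>S\<close>-orbits meeting the breaks of \<open>S\<close>. If \<open>d\<close> is the first
  break on such an orbit and \<open>l\<close> the last, then \<open>S\<^sup>-\<^sup>(\<^sup>n\<^sup>-\<^sup>1\<^sup>)d\<close> and \<open>l\<close> are distinct breaks of \<open>T\<close>; only
  for \<open>l\<close>, and only on the orbit of \<open>0\<close>, can this fail. Hence \<open>2 p - 1 \<le> m - 1\<close>. On the other hand,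
  let \<open>P\<^sub>N\<close> be the set of points reaching a break of \<open>S\<close> in at most \<open>N\<close> steps. By minimality
  \<open>f \<mapsto> f - f \<circ> S\<close> has only the constants as kernel on rational step functions jumping on \<open>P\<^sub>N\<close>,
  and its image consists of step functions of integral \<open>0\<close> jumping on \<open>P\<^sub>N\<^sub>+\<^sub>1\<close>. By rank-nullity the
  rational span of \<open>P\<^sub>N\<^sub>+\<^sub>1 \<union> {1}\<close>, which contains all lengths of \<open>T\<close> for \<open>N \<ge> n\<close>, has dimension at
  most \<open>1 + |P\<^sub>N\<^sub>+\<^sub>1| - |P\<^sub>N|\<close>, and this is at most \<open>1 + p\<close> for large \<open>N\<close>.
\<close>

section \<open>Left breaks\<close>

text \<open>Maps here are translations to the right of every point, so a break is visible on the left only.\<close>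

definition left_translation :: "(real \<Rightarrow> real) \<Rightarrow> real \<Rightarrow> bool" where
  "left_translation f x \<longleftrightarrow> (\<exists>e>0. \<forall>d. 0 \<le> d \<and> d \<le> e \<longrightarrow> f (x - d) = f x - d)"

definition left_breaks :: "(real \<Rightarrow> real) \<Rightarrow> real set" where
  "left_breaks f = {x \<in> {0<..<1}. \<not> left_translation f x}"

lemma left_translation_comp:
  assumes "left_translation f x" "left_translation g (f x)"
  shows "left_translation (g \<circ> f) x"
proof -
  obtain e where e: "e > 0" "\<And>d. 0 \<le> d \<Longrightarrow> d \<le> e \<Longrightarrow> f (x - d) = f x - d"
    using assms(1) by (auto simp: left_translation_def)
  obtain e' where e': "e' > 0" "\<And>d. 0 \<le> d \<Longrightarrow> d \<le> e' \<Longrightarrow> g (f x - d) = g (f x) - d"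
    using assms(2) by (auto simp: left_translation_def)
  show ?thesis unfolding left_translation_def
    by (rule exI[of _ "min e e'"]) (use e e' in auto)
qed

text \<open>Points just left of \<open>f x\<close> are \<open>f\<close>-images of points just left
  of \<open>x\<close>. Contrapositively, a break of the outer map survives composition when the
  inner map translates; this makes first breaks visible in \<open>S ^^ n\<close>.\<close>

lemma left_translation_outer:
  assumes "left_translation f x" "left_translation (g \<circ> f) x"
  shows "left_translation g (f x)"
proof -
  obtain e where e: "e > 0" "\<And>d. 0 \<le> d \<Longrightarrow> d \<le> e \<Longrightarrow> f (x - d) = f x - d"
    using assms(1) by (auto simp: left_translation_def)
  obtain e' where e': "e' > 0" "\<And>d. 0 \<le> d \<Longrightarrow> d \<le> e' \<Longrightarrow> g (f (x - d)) = g (f x) - d"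
    using assms(2) by (auto simp: left_translation_def)
  have "g (f x - d) = g (f x) - d" if "0 \<le> d" "d \<le> min e e'" for d
    using e(2)[of d] e'(2)[of d] that by auto
  then show ?thesis unfolding left_translation_def
    using e(1) e'(1) by (intro exI[of _ "min e e'"]) auto
qed

text \<open>Injectivity cancels \<open>g\<close>. Contrapositively, an outer map that translates to
  the left of \<open>f x\<close> cannot repair a break of \<open>f\<close>; this makes last breaks
  visible in \<open>S ^^ n\<close>.\<close>

lemma left_translation_inner:
  assumes "inj g" "left_translation g (f x)" "left_translation (g \<circ> f) x"
  shows "left_translation f x"
proof -
  obtain e where e: "e > 0" "\<And>d. 0 \<le> d \<Longrightarrow> d \<le> e \<Longrightarrow> g (f x - d) = g (f x) - d"
    using assms(2) by (auto simp: left_translation_def)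
  obtain e' where e': "e' > 0" "\<And>d. 0 \<le> d \<Longrightarrow> d \<le> e' \<Longrightarrow> g (f (x - d)) = g (f x) - d"
    using assms(3) by (auto simp: left_translation_def)
  have "f (x - d) = f x - d" if "0 \<le> d" "d \<le> min e e'" for d
    using e(2)[of d] e'(2)[of d] that by (auto intro: injD[OF assms(1), of "f (x - d)"])
  then show ?thesis unfolding left_translation_def
    using e(1) e'(1) by (intro exI[of _ "min e e'"]) auto
qed

lemma left_translation_funpow:
  assumes "\<And>i. i < k \<Longrightarrow> left_translation f ((f ^^ i) x)"
  shows "left_translation (f ^^ k) x"
  using assms
proof (induction k)
  case 0
  show ?case by (auto simp: left_translation_def intro: exI[of _ 1])
next
  case (Suc k)
  then show ?case using left_translation_comp[of "f ^^ k" x f] by (simp add: comp_def)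
qed

section \<open>Piecewise translations with finitely many breaks\<close>

lemma finite_gap_left:
  fixes x :: real
  assumes "finite B"
  obtains e where "e > 0" "{x - e<..<x} \<inter> B = {}"
proof -
  obtain e where e: "e > 0" "ball x e \<inter> (B - {x}) = {}"
    using finite_set_avoid[OF assms, of x] by (force simp: disjoint_iff dist_commute not_less)
  have "{x - e<..<x} \<subseteq> ball x e - {x}" by (auto simp: dist_real_def)
  then have "{x - e<..<x} \<inter> B = {}" using e(2) by blast
  then show ?thesis using e(1) that by blast
qed

lemma finite_gap_right:
  fixes x :: real
  assumes "finite B"
  obtains e where "e > 0" "{x<..<x + e} \<inter> B = {}"
proof -
  obtain e where e: "e > 0" "ball x e \<inter> (B - {x}) = {}"
    using finite_set_avoid[OF assms, of x] by (force simp: disjoint_iff dist_commute not_less)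
  have "{x<..<x + e} \<subseteq> ball x e - {x}" by (auto simp: dist_real_def)
  then have "{x<..<x + e} \<inter> B = {}" using e(2) by blast
  then show ?thesis using e(1) that by blast
qed

text \<open>The displacement is a step function jumping only on \<open>B\<close>. The interval omits
  \<open>x\<close>, since a jump at \<open>x\<close> is already part of the value there.\<close>

definition translates_off :: "(real \<Rightarrow> real) \<Rightarrow> real set \<Rightarrow> bool" where
  "translates_off f B \<longleftrightarrow>
     (\<forall>x y. 0 \<le> x \<longrightarrow> x \<le> y \<longrightarrow> y < 1 \<longrightarrow> {x<..y} \<inter> B = {} \<longrightarrow> f y - y = f x - x)"

lemma translates_offD:
  "\<lbrakk>translates_off f B; 0 \<le> x; x \<le> y; y < 1; {x<..y} \<inter> B = {}\<rbrakk> \<Longrightarrow> f y - y = f x - x"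
  unfolding translates_off_def by blast

lemma left_breaks_subset:
  assumes "finite B" "translates_off f B"
  shows "left_breaks f \<subseteq> B"
proof
  fix x assume x: "x \<in> left_breaks f"
  then have x01: "0 < x" "x < 1" by (auto simp: left_breaks_def)
  show "x \<in> B"
  proof (rule ccontr)
    assume "x \<notin> B"
    obtain e where e: "e > 0" "{x - e<..<x} \<inter> B = {}"
      using finite_gap_left[OF assms(1)] .
    define e' where "e' = min (e / 2) x"
    have "f (x - d) = f x - d" if "0 \<le> d" "d \<le> e'" for d
    proof -
      have "{x - d<..x} \<subseteq> insert x {x - e<..<x}"
        using that e(1) by (auto simp: e'_def)
      then have "{x - d<..x} \<inter> B = {}" using e(2) \<open>x \<notin> B\<close> by blast
      then have "f x - x = f (x - d) - (x - d)"
        using that x01 by (intro translates_offD[OF assms(2)]) (auto simp: e'_def)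
      then show ?thesis by simp
    qed
    moreover have "e' > 0" using e x01 by (simp add: e'_def)
    ultimately have "left_translation f x" by (auto simp: left_translation_def)
    then show False using x by (simp add: left_breaks_def)
  qed
qed

text \<open>Points of \<open>B\<close> that are no breaks can be skipped: from \<open>y\<close> one
  moves left to the largest such point \<open>b\<close>, then past it by the left translation at
  \<open>b\<close>, and inducts on the number of points of \<open>B\<close> in the interval.\<close>

lemma translates_off_left_breaks:
  assumes "finite B" "translates_off f B"
  shows "translates_off f (left_breaks f)"
proof -
  have "f y - y = f x - x"
    if "0 \<le> x" "x \<le> y" "y < 1" "{x<..y} \<inter> left_breaks f = {}" for x y
    using that
  proof (induction "card (B \<inter> {x<..y})" arbitrary: y rule: less_induct)
    case less
    show ?case
    proof (cases "B \<inter> {x<..y} = {}")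
      case True
      then show ?thesis
        using less.prems by (intro translates_offD[OF assms(2)]) (auto simp: Int_commute)
    next
      case False
      have fin: "finite (B \<inter> {x<..y})" using assms(1) by simp
      define b where "b = Max (B \<inter> {x<..y})"
      have b: "b \<in> B" "x < b" "b \<le> y"
        using Max_in[OF fin False] by (auto simp: b_def)
      have "b \<notin> left_breaks f" using less.prems(4) b by auto
      then have "left_translation f b"
        using b less.prems by (auto simp: left_breaks_def)
      then obtain e where e: "e > 0" "\<And>d. 0 \<le> d \<Longrightarrow> d \<le> e \<Longrightarrow> f (b - d) = f b - d"
        by (auto simp: left_translation_def)
      define d where "d = min e (b - x)"
      have d: "d > 0" "d \<le> e" "d \<le> b - x" using e b by (auto simp: d_def)
      have "{b<..y} \<inter> B = {}"
      proof (rule ccontr)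
        assume "{b<..y} \<inter> B \<noteq> {}"
        then obtain c where "c \<in> B" "b < c" "c \<le> y" by auto
        then show False using Max_ge[OF fin, of c] b by (auto simp: b_def)
      qed
      then have 1: "f y - y = f b - b"
        using b less.prems by (intro translates_offD[OF assms(2)]) auto
      have sub: "b \<notin> {x<..b - d}" "{x<..b - d} \<subseteq> {x<..y}" using b d by auto
      from sub have "B \<inter> {x<..b - d} \<subseteq> B \<inter> {x<..y}" "b \<in> B \<inter> {x<..y} - B \<inter> {x<..b - d}"
        using b by auto
      then have "B \<inter> {x<..b - d} \<subset> B \<inter> {x<..y}" by blast
      then have "card (B \<inter> {x<..b - d}) < card (B \<inter> {x<..y})"
        using fin psubset_card_mono by blast
      moreover have "{x<..b - d} \<inter> left_breaks f = {}"
        using less.prems(4) sub by blast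
      ultimately have "f (b - d) - (b - d) = f x - x"
        using less.hyps[of "b - d"] less.prems b d by auto
      then show ?thesis using 1 e(2)[of d] d by simp
    qed
  qed
  then show ?thesis unfolding translates_off_def by blast
qed

text \<open>Finiteness of \<open>B\<close> makes \<open>f\<close> a translation to the right of
  every point, so off the left breaks it is one on both sides; at \<open>0\<close> the domain has no
  left side. This inclusion suffices for an upper bound on the rank.\<close>

lemma discontinuities_subset_left_breaks:
  assumes "finite B" "translates_off f B"
  shows "discontinuities f \<subseteq> left_breaks f"
proof
  fix x assume x: "x \<in> discontinuities f"
  then have x01: "0 \<le> x" "x < 1" and disc: "\<not> continuous (at x within {0..<1}) f"
    by (auto simp: discontinuities_def)
  show "x \<in> left_breaks f"
  proof (rule ccontr)
    assume nb: "x \<notin> left_breaks f"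
    obtain e where e: "e > 0" "{x<..<x + e} \<inter> B = {}"
      using finite_gap_right[OF assms(1)] .
    have right: "f y - y = f x - x" if "x \<le> y" "y < 1" "y < x + e" for y
    proof -
      have "{x<..y} \<subseteq> {x<..<x + e}" using that by auto
      then have "{x<..y} \<inter> B = {}" using e(2) by blast
      with x01 that show ?thesis by (intro translates_offD[OF assms(2)]) auto
    qed
    obtain e' where e': "e' > 0" "\<And>y. 0 \<le> y \<Longrightarrow> y \<le> x \<Longrightarrow> x - e' < y \<Longrightarrow> f y - y = f x - x"
    proof (cases "x = 0")
      case True
      then show ?thesis using that[of 1] by auto
    next
      case False
      then have "left_translation f x" using nb x01 by (auto simp: left_breaks_def)
      then obtain d where d: "d > 0" "\<And>s. 0 \<le> s \<Longrightarrow> s \<le> d \<Longrightarrow> f (x - s) = f x - s"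
        by (auto simp: left_translation_def)
      show ?thesis
      proof (rule that[OF d(1)])
        fix y assume "y \<le> x" "x - d < y"
        then show "f y - y = f x - x" using d(2)[of "x - y"] by simp
      qed
    qed
    have "continuous (at x within {0..<1}) (\<lambda>y. y + (f x - x))"
      by (intro continuous_intros)
    then have "continuous (at x within {0..<1}) f"
    proof (rule continuous_transform_within)
      show "0 < min e e'" using e(1) e'(1) by simp
      show "x \<in> {0..<1}" using x01 by simp
      fix y assume y: "y \<in> {0..<1}" "dist y x < min e e'"
      show "y + (f x - x) = f y"
        using right[of y] e'(2)[of y] y by (cases "x \<le> y") (auto simp: dist_real_def)
    qed
    then show False using disc by simp
  qed
qed

section \<open>Interval exchange transformations as piecewise translations\<close>

lemma iet_beta_0 [simp]: "iet_beta lam 0 = 0"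
  by (simp add: iet_beta_def)

lemma iet_beta_Suc: "iet_beta lam (Suc j) = iet_beta lam j + lam (Suc j)"
  by (simp add: iet_beta_def)

lemma iet_beta_pred: "1 \<le> j \<Longrightarrow> iet_beta lam j = iet_beta lam (j - 1) + lam j"
  using iet_beta_Suc[of lam "j - 1"] by simp

lemma iet_beta_less:
  assumes "iet_data m \<pi> lam" "j < k" "k \<le> m"
  shows "iet_beta lam j < iet_beta lam k"
  using assms(2,3)
proof (induction k)
  case (Suc k)
  have "lam (Suc k) > 0" using assms(1) Suc.prems by (auto simp: iet_data_def)
  then show ?case using Suc by (cases "j = k") (auto simp: iet_beta_Suc)
qed simp

lemma iet_beta_mono:
  assumes "iet_data m \<pi> lam" "j \<le> k" "k \<le> m"
  shows "iet_beta lam j \<le> iet_beta lam k"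
  using iet_beta_less[OF assms(1), of j k] assms by (cases "j = k") auto

lemma iet_beta_m: "iet_data m \<pi> lam \<Longrightarrow> iet_beta lam m = 1"
  by (simp add: iet_data_def iet_beta_def)

lemma iet_interval_subset:
  assumes "iet_data m \<pi> lam" "j \<in> {1..m}"
  shows "iet_interval lam j \<subseteq> {0..<1}"
proof -
  have "j - 1 \<le> m" "j \<le> m" using assms(2) by auto
  then show ?thesis
    using iet_beta_mono[OF assms(1), of 0 "j - 1"] iet_beta_mono[OF assms(1), of j m]
      iet_beta_m[OF assms(1)] by (auto simp: iet_interval_def)
qed

lemma iet_interval_ex:
  assumes "iet_data m \<pi> lam" "x \<in> {0..<1}"
  obtains j where "j \<in> {1..m}" "x \<in> iet_interval lam j"
proof -
  define j where "j = (LEAST j. x < iet_beta lam j)"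
  have m: "x < iet_beta lam m" using assms iet_beta_m by auto
  have j: "x < iet_beta lam j" unfolding j_def by (rule LeastI[of _ m]) (rule m)
  have "j \<le> m" unfolding j_def by (rule Least_le) (rule m)
  have "j \<noteq> 0" using j assms(2) by (cases "j = 0") auto
  have "\<not> x < iet_beta lam (j - 1)"
    using not_less_Least[of "j - 1" "\<lambda>j. x < iet_beta lam j"] \<open>j \<noteq> 0\<close> by (auto simp: j_def[symmetric])
  then show ?thesis using that[of j] j \<open>j \<le> m\<close> \<open>j \<noteq> 0\<close> by (auto simp: iet_interval_def)
qed

lemma iet_interval_unique:
  assumes "iet_data m \<pi> lam" "j \<in> {1..m}" "k \<in> {1..m}"
    "x \<in> iet_interval lam j" "x \<in> iet_interval lam k"
  shows "j = k"
proof -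
  have "\<not> j < k" if "j \<in> {1..m}" "k \<in> {1..m}" "x \<in> iet_interval lam j" "x \<in> iet_interval lam k"
    for j k
  proof
    assume "j < k"
    then have "j \<le> k - 1" "k - 1 \<le> m" using that by auto
    then show False
      using iet_beta_mono[OF assms(1), of j "k - 1"] that by (auto simp: iet_interval_def)
  qed
  then show ?thesis using assms(2-5) by (metis nat_neq_iff)
qed

text \<open>These are the data of the inverse exchange: its intervals are the images of the original
  ones, listed from left to right.\<close>

lemma iet_data_inv:
  assumes "iet_data m \<pi> lam"
  shows "iet_data m (inv \<pi>) (lam \<circ> inv \<pi>)"
proof -
  have p: "inv \<pi> permutes {1..m}" using assms by (auto simp: iet_data_def intro: permutes_inv)
  have "(\<Sum>i=1..m. (lam \<circ> inv \<pi>) i) = (\<Sum>i=1..m. lam i)"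
    using sum.permute[OF p, of lam] by simp
  then show ?thesis using assms p permutes_in_image[OF p] by (auto simp: iet_data_def)
qed

lemma iet_beta_image:
  assumes "iet_data m \<pi> lam" "j \<in> {1..m}"
  shows "(\<Sum>i | i \<in> {1..m} \<and> \<pi> i < \<pi> j. lam i) = iet_beta (lam \<circ> inv \<pi>) (\<pi> j - 1)"
proof -
  have p: "\<pi> permutes {1..m}" using assms by (auto simp: iet_data_def)
  have "\<pi> j \<in> {1..m}" using permutes_in_image[OF p] assms(2) by simp
  then have "inv \<pi> k \<in> {1..m}" if "1 \<le> k" "k \<le> \<pi> j - 1" for k
    using permutes_in_image[OF permutes_inv[OF p], of k] that by auto
  moreover have "\<pi> k \<in> {1..m}" if "k \<in> {1..m}" for k
    using permutes_in_image[OF p] that by simp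
  ultimately show ?thesis unfolding iet_beta_def
    using permutes_inverses[OF p]
    by (intro sum.reindex_bij_witness[of _ "inv \<pi>" \<pi>]) fastforce+
qed

lemma iet_formula:
  assumes "iet_data m \<pi> lam" "j \<in> {1..m}" "x \<in> iet_interval lam j"
  shows "iet m \<pi> lam x = x - iet_beta lam (j - 1) + iet_beta (lam \<circ> inv \<pi>) (\<pi> j - 1)"
proof -
  have "(THE j. j \<in> {1..m} \<and> x \<in> iet_interval lam j) = j"
    using iet_interval_unique[OF assms(1)] assms(2,3) by (intro the_equality) auto
  moreover have "x \<in> {0..<1}" using iet_interval_subset assms by blast
  moreover have "{i. i \<in> {1..m} \<and> i < j} = {1..j - 1}" using assms(2) by auto
  ultimately show ?thesis
    using iet_beta_image[OF assms(1,2)] by (simp add: iet_def iet_beta_def del: atLeastAtMost_iff)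
qed

lemma iet_in_interval:
  assumes "iet_data m \<pi> lam" "j \<in> {1..m}" "x \<in> iet_interval lam j"
  shows "iet m \<pi> lam x \<in> iet_interval (lam \<circ> inv \<pi>) (\<pi> j)"
proof -
  have p: "\<pi> permutes {1..m}" using assms by (auto simp: iet_data_def)
  have "\<pi> j \<in> {1..m}" using permutes_in_image[OF p] assms(2) by simp
  then have "iet_beta (lam \<circ> inv \<pi>) (\<pi> j) = iet_beta (lam \<circ> inv \<pi>) (\<pi> j - 1) + lam j"
    using iet_beta_pred[of "\<pi> j" "lam \<circ> inv \<pi>"] permutes_inverses[OF p] by simp
  moreover have "iet_beta lam j = iet_beta lam (j - 1) + lam j"
    using iet_beta_pred assms(2) by simp
  ultimately show ?thesis
    using iet_formula[OF assms] assms(3) by (auto simp: iet_interval_def)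
qed

lemma iet_outside: "x \<notin> {0..<1} \<Longrightarrow> iet m \<pi> lam x = x"
  by (simp add: iet_def del: atLeastLessThan_iff)

lemma iet_in_unit:
  assumes "iet_data m \<pi> lam"
  shows "iet m \<pi> lam x \<in> {0..<1} \<longleftrightarrow> x \<in> {0..<1}"
proof (cases "x \<in> {0..<1}")
  case True
  obtain j where j: "j \<in> {1..m}" "x \<in> iet_interval lam j" using iet_interval_ex[OF assms True] .
  have "\<pi> j \<in> {1..m}" using assms j(1) permutes_in_image unfolding iet_data_def by metis
  then show ?thesis
    using iet_in_interval[OF assms j] iet_interval_subset[OF iet_data_inv[OF assms]] True by blast
qed (simp add: iet_outside del: atLeastLessThan_iff)

lemma iet_left_inverse:
  assumes "iet_data m \<pi> lam"
  shows "iet m (inv \<pi>) (lam \<circ> inv \<pi>) (iet m \<pi> lam x) = x"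
proof (cases "x \<in> {0..<1}")
  case True
  have p: "\<pi> permutes {1..m}" using assms by (auto simp: iet_data_def)
  obtain j where j: "j \<in> {1..m}" "x \<in> iet_interval lam j" using iet_interval_ex[OF assms True] .
  have "\<pi> j \<in> {1..m}" using permutes_in_image[OF p] j by simp
  note f = iet_formula[OF iet_data_inv[OF assms] this iet_in_interval[OF assms j]]
  have "lam \<circ> inv \<pi> \<circ> inv (inv \<pi>) = lam" "inv \<pi> (\<pi> j) = j"
    using p by (auto simp: permutes_inv_inv permutes_inverses fun_eq_iff)
  then show ?thesis using f iet_formula[OF assms j] by simp
qed (simp add: iet_outside del: atLeastLessThan_iff)

lemma bij_iet:
  assumes "iet_data m \<pi> lam"
  shows "bij (iet m \<pi> lam)"
proof (rule o_bij)
  have p: "\<pi> permutes {1..m}" using assms by (auto simp: iet_data_def)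
  show "iet m (inv \<pi>) (lam \<circ> inv \<pi>) \<circ> iet m \<pi> lam = id"
    using iet_left_inverse[OF assms] by (simp add: fun_eq_iff)
  have "lam \<circ> inv \<pi> \<circ> inv (inv \<pi>) = lam" "inv (inv \<pi>) = \<pi>"
    using p by (auto simp: permutes_inv_inv permutes_inverses fun_eq_iff)
  then show "iet m \<pi> lam \<circ> iet m (inv \<pi>) (lam \<circ> inv \<pi>) = id"
    using iet_left_inverse[OF iet_data_inv[OF assms]] by (metis comp_apply eq_id_iff)
qed

lemma iet_translates_off:
  assumes "iet_data m \<pi> lam"
  shows "translates_off (iet m \<pi> lam) (iet_beta lam ` {1..m - 1})"
  unfolding translates_off_def
proof (intro allI impI)
  fix x y :: real
  assume xy: "0 \<le> x" "x \<le> y" "y < 1" "{x<..y} \<inter> iet_beta lam ` {1..m - 1} = {}"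
  obtain j where j: "j \<in> {1..m}" "x \<in> iet_interval lam j"
    using iet_interval_ex[OF assms, of x] xy by auto
  have "y \<in> iet_interval lam j"
  proof (rule ccontr)
    assume "y \<notin> iet_interval lam j"
    then have b: "x < iet_beta lam j" "iet_beta lam j \<le> y" using j xy by (auto simp: iet_interval_def)
    then have "j \<noteq> m" using iet_beta_m[OF assms] xy by auto
    then have "iet_beta lam j \<in> iet_beta lam ` {1..m - 1}" using j by auto
    then show False using b xy by auto
  qed
  then show "iet m \<pi> lam y - y = iet m \<pi> lam x - x"
    using iet_formula[OF assms j(1)] j by simp
qed

text \<open>The part of a piece sent to \<open>[x, 1)\<close> is as long as the part of its image in
  \<open>[x, 1)\<close>, and the images tile \<open>[0, 1)\<close>. This is what gives coboundaries
  the integral \<open>0\<close>.\<close>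

lemma iet_measure_preserving:
  assumes "iet_data m \<pi> lam" "0 \<le> x" "x \<le> 1"
  shows "{t \<in> {0..<1}. x \<le> iet m \<pi> lam t} \<in> sets lborel"
    and "measure lborel {t \<in> {0..<1}. x \<le> iet m \<pi> lam t} = 1 - x"
proof -
  have p: "\<pi> permutes {1..m}" using assms by (auto simp: iet_data_def)
  let ?b = "iet_beta lam" and ?b' = "iet_beta (lam \<circ> inv \<pi>)"
  \<comment> \<open>\<open>c j\<close> is the displacement on piece \<open>j\<close>,
    \<open>J j\<close> the part of it sent to \<open>[x, 1)\<close>, and \<open>F k\<close> the
    length above \<open>x\<close> of the image at position \<open>k\<close>. The maxima also cover
    an empty part, of length \<open>0\<close>.\<close>
  define c where "c j = ?b' (\<pi> j - 1) - ?b (j - 1)" for j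
  define J where "J j = {max (?b (j - 1)) (x - c j)..<?b j}" for j
  define F where "F k = max (?b' k) x - max (?b' (k - 1)) x" for k
  have J_eq: "J j = {t \<in> iet_interval lam j. x \<le> iet m \<pi> lam t}" if "j \<in> {1..m}" for j
    using iet_formula[OF assms(1) that] by (auto simp: J_def c_def iet_interval_def)
  have Un: "{t \<in> {0..<1}. x \<le> iet m \<pi> lam t} = (\<Union>j\<in>{1..m}. J j)"
  proof (intro set_eqI iffI)
    fix t assume t: "t \<in> {t \<in> {0..<1}. x \<le> iet m \<pi> lam t}"
    then have "t \<in> {0..<1}" by simp
    then obtain j where "j \<in> {1..m}" "t \<in> iet_interval lam j" by (rule iet_interval_ex[OF assms(1)])
    then show "t \<in> (\<Union>j\<in>{1..m}. J j)" using t J_eq[of j] by blast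
  next
    fix t assume "t \<in> (\<Union>j\<in>{1..m}. J j)"
    then obtain j where j: "j \<in> {1..m}" "t \<in> J j" by blast
    show "t \<in> {t \<in> {0..<1}. x \<le> iet m \<pi> lam t}"
      using j(2) iet_interval_subset[OF assms(1) j(1)] unfolding J_eq[OF j(1)] by auto
  qed
  show "{t \<in> {0..<1}. x \<le> iet m \<pi> lam t} \<in> sets lborel"
    unfolding Un by (intro sets.finite_UN) (auto simp: J_def)
  have mJ: "measure lborel (J j) = F (\<pi> j)" if j: "j \<in> {1..m}" for j
  proof -
    have "\<pi> j \<in> {1..m}" using permutes_in_image[OF p] j by simp
    then have 1: "?b' (\<pi> j) = ?b' (\<pi> j - 1) + lam j"
      using iet_beta_pred[of "\<pi> j" "lam \<circ> inv \<pi>"] permutes_inverses[OF p] by simp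
    have 2: "?b j = ?b (j - 1) + lam j" "lam j > 0"
      using iet_beta_pred assms(1) j by (auto simp: iet_data_def)
    show ?thesis
      using 1 2 by (simp add: J_def F_def c_def max_def)
  qed
  have "disjoint_family_on J {1..m}"
    unfolding disjoint_family_on_def
  proof (intro ballI impI)
    fix j k assume jk: "j \<in> {1..m}" "k \<in> {1..m}" "j \<noteq> k"
    show "J j \<inter> J k = {}"
      using iet_interval_unique[OF assms(1) jk(1,2)] jk(3) unfolding J_eq[OF jk(1)] J_eq[OF jk(2)]
      by blast
  qed
  then have "measure lborel (\<Union>j\<in>{1..m}. J j) = (\<Sum>j\<in>{1..m}. measure lborel (J j))"
  proof (intro measure_finite_Union)
    show "emeasure lborel (J j) \<noteq> \<infinity>" for j
      using emeasure_bounded_finite[of "J j"] by (simp add: J_def)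
    show "J ` {1..m} \<subseteq> sets lborel" by (auto simp: J_def)
  qed auto
  also have "\<dots> = (\<Sum>j\<in>{1..m}. F (\<pi> j))"
    by (rule sum.cong[OF refl mJ])
  \<comment> \<open>Summing in the order of the images makes the lengths telescope.\<close>
  also have "\<dots> = (\<Sum>k\<in>{1..m}. F k)"
    using sum.permute[OF p, of F] by simp
  also have "\<dots> = max (?b' m) x - max (?b' 0) x"
    unfolding F_def using sum_telescope''[of 0 m "\<lambda>k. max (?b' k) x"] by simp
  also have "\<dots> = 1 - x"
    using iet_beta_m[OF iet_data_inv[OF assms(1)]] assms(2,3) by simp
  finally show "measure lborel {t \<in> {0..<1}. x \<le> iet m \<pi> lam t} = 1 - x"
    unfolding Un .
qed

section \<open>Minimal exchanges\<close>

text \<open>Gaussian elimination: an equation \<open>r\<close> without nonzero coefficients is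
  dropped; otherwise it is solved for a pivot unknown \<open>b\<close>, and substitution leaves one
  equation and one unknown fewer. The rank-nullity argument is run through such a system.\<close>

lemma homogeneous_system:
  fixes u :: "'a \<Rightarrow> 'b \<Rightarrow> 'k::field"
  assumes "finite R" "finite A" "card R < card A"
  shows "\<exists>c. (\<exists>a\<in>A. c a \<noteq> 0) \<and> (\<forall>r\<in>R. (\<Sum>a\<in>A. c a * u a r) = 0)"
  using assms
proof (induction R arbitrary: A u rule: finite_induct)
  case empty
  then have "A \<noteq> {}" by auto
  then show ?case by (intro exI[of _ "\<lambda>_. 1"]) auto
next
  case (insert r R)
  show ?case
  proof (cases "\<forall>a\<in>A. u a r = 0")
    case True
    have "card R < card A" using insert by simp
    from insert.IH[OF insert.prems(1) this, of u] show ?thesis using True by auto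
  next
    case False
    then obtain b where b: "b \<in> A" "u b r \<noteq> 0" by blast
    define A' where "A' = A - {b}"
    have A: "A = insert b A'" "b \<notin> A'" "finite A'" using b insert.prems by (auto simp: A'_def)
    then have "card R < card A'" using insert by simp
    from insert.IH[OF A(3) this, of "\<lambda>a s. u a s - u a r / u b r * u b s"]
    obtain c where c: "\<exists>a\<in>A'. c a \<noteq> 0"
      "\<And>s. s \<in> R \<Longrightarrow> (\<Sum>a\<in>A'. c a * (u a s - u a r / u b r * u b s)) = 0" by blast
    define c' where "c' = c(b := - (\<Sum>a\<in>A'. c a * u a r) / u b r)"
    have sum_c': "(\<Sum>a\<in>A. c' a * u a s) = c' b * u b s + (\<Sum>a\<in>A'. c a * u a s)" for s
    proof -
      have "(\<Sum>a\<in>A'. c' a * u a s) = (\<Sum>a\<in>A'. c a * u a s)"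
        using A(2) by (intro sum.cong) (auto simp: c'_def)
      then show ?thesis using A by simp
    qed
    have "(\<Sum>a\<in>A. c' a * u a s) = 0" if "s \<in> R" for s
    proof -
      have "(\<Sum>a\<in>A'. c a * (u a r / u b r * u b s)) = (\<Sum>a\<in>A'. c a * u a r) / u b r * u b s"
        unfolding sum_divide_distrib sum_distrib_right by (simp add: mult.assoc)
      then show ?thesis
        using c(2)[OF that] unfolding sum_c'
        by (simp add: c'_def right_diff_distrib sum_subtractf)
    qed
    moreover have "(\<Sum>a\<in>A. c' a * u a r) = 0"
      unfolding sum_c' using b(2) by (simp add: c'_def)
    moreover have "\<exists>a\<in>A. c' a \<noteq> 0" using c(1) A by (auto simp: c'_def)
    ultimately show ?thesis by auto
  qed
qed

text \<open>The properties of a root that the argument uses. Minimality is phrased through invariant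
  sets because it is applied to periodic orbits and to level sets of step functions.\<close>

locale minimal_exchange =
  fixes S :: "real \<Rightarrow> real"
  assumes bij: "bij S"
    and unit: "S x \<in> {0..<1} \<longleftrightarrow> x \<in> {0..<1}"
    and fin: "finite (left_breaks S)"
    and transl: "translates_off S (left_breaks S)"
    and sets_pre: "\<lbrakk>0 \<le> x; x \<le> 1\<rbrakk> \<Longrightarrow> {t \<in> {0..<1}. x \<le> S t} \<in> sets lborel"
    and measure_pre: "\<lbrakk>0 \<le> x; x \<le> 1\<rbrakk> \<Longrightarrow> measure lborel {t \<in> {0..<1}. x \<le> S t} = 1 - x"
    and minimal: "\<lbrakk>x \<in> {0..<1}; \<And>y. S y \<in> A \<longleftrightarrow> y \<in> A; x \<in> A; 0 \<le> a; a < b; b \<le> 1\<rbrakk>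
      \<Longrightarrow> \<exists>y\<in>A. a < y \<and> y < b"
begin

text \<open>The sets \<open>P\<^sub>N\<close>. The point \<open>0\<close> may reach a break, but is
  removed because a step function on \<open>[0, 1)\<close> has no jump there.\<close>

definition pre_breaks :: "nat \<Rightarrow> real set" where
  "pre_breaks N = {x. \<exists>k\<le>N. (S ^^ k) x \<in> left_breaks S} - {0}"

text \<open>As no orbit in \<open>[0, 1)\<close> is periodic, each orbit meeting the breaks has
  exactly one such break, so their number is the \<open>p\<close> of the overview.\<close>

definition initial_breaks :: "real set" where
  "initial_breaks = {d \<in> left_breaks S. \<forall>k>0. \<forall>e\<in>left_breaks S. (S ^^ k) e \<noteq> d}"

lemma initial_breaksD:
  "\<lbrakk>d \<in> initial_breaks; k > 0; e \<in> left_breaks S\<rbrakk> \<Longrightarrow> (S ^^ k) e \<noteq> d"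
  by (simp add: initial_breaks_def)

section \<open>Orbits, aperiodicity and the point \<open>0\<close>\<close>

lemma inj_pow: "inj (S ^^ k)"
  using bij by (simp add: inj_fn bij_is_inj)

lemma pow_surj: obtains w where "(S ^^ k) w = x"
  using bij_fn[OF bij, of k] by (metis bij_pointE)

lemma unit_pow: "(S ^^ k) x \<in> {0..<1} \<longleftrightarrow> x \<in> {0..<1}"
  by (induction k) (use unit in auto)

lemma breaks_unit: "d \<in> left_breaks S \<Longrightarrow> d \<in> {0..<1}"
  by (simp add: left_breaks_def)

text \<open>A periodic orbit is a finite invariant set, so it misses an interval next to
  \<open>0\<close>, against minimality.\<close>

lemma aperiodic:
  assumes "x \<in> {0..<1}" "k > 0"
  shows "(S ^^ k) x \<noteq> x"
proof
  assume per: "(S ^^ k) x = x"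
  define A where "A = range (\<lambda>i. (S ^^ i) x)"
  have "A \<subseteq> (\<lambda>i. (S ^^ i) x) ` {..<k}"
  proof
    fix y assume "y \<in> A"
    then obtain i where "y = (S ^^ i) x" by (auto simp: A_def)
    then have "y = (S ^^ (i mod k)) x" using funpow_mod_eq[OF per, of i] by simp
    then show "y \<in> (\<lambda>i. (S ^^ i) x) ` {..<k}" using assms(2) by auto
  qed
  then have "finite A" using finite_surj by blast
  then obtain e where e: "e > 0" "{0<..<0 + e} \<inter> A = {}" by (rule finite_gap_right)
  have "S y \<in> A \<longleftrightarrow> y \<in> A" for y
  proof
    assume "y \<in> A"
    then obtain i where "y = (S ^^ i) x" by (auto simp: A_def)
    then have "S y = (S ^^ Suc i) x" by simp
    then show "S y \<in> A" unfolding A_def by blast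
  next
    assume "S y \<in> A"
    then obtain i where "S y = (S ^^ i) x" by (auto simp: A_def)
    \<comment> \<open>Adding a period makes the exponent positive, so that the preimage is again in
      the forward orbit.\<close>
    also have "\<dots> = (S ^^ (i + k)) x" using per by (simp add: funpow_add)
    also have "\<dots> = S ((S ^^ (i + k - 1)) x)"
      using assms(2) funpow.simps(2)[of "i + k - 1" S] by simp
    finally have "y = (S ^^ (i + k - 1)) x" using bij by (simp add: bij_is_inj inj_eq)
    then show "y \<in> A" unfolding A_def by blast
  qed
  moreover have "x \<in> A" unfolding A_def using funpow_0 by (intro image_eqI[of _ _ 0]) auto
  ultimately have "\<exists>y\<in>A. 0 < y \<and> y < min e 1"
    using e(1) assms(1) by (intro minimal[of x A]) auto
  then show False using e(2) by auto
qed

text \<open>A left translation at \<open>z\<close> would send points of \<open>[0, 1)\<close> below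
  \<open>0\<close>; that \<open>z\<close> is not \<open>0\<close> itself is aperiodicity.\<close>

lemma zero_preimage_break:
  assumes "S z = 0"
  shows "z \<in> left_breaks S"
proof (rule ccontr)
  assume nb: "z \<notin> left_breaks S"
  have z: "z \<in> {0..<1}" using unit[of z] assms by simp
  have "z \<noteq> 0" using aperiodic[of 0 1] assms by auto
  then have "left_translation S z" using nb z by (auto simp: left_breaks_def)
  then obtain e where e: "e > 0" "\<And>d. 0 \<le> d \<Longrightarrow> d \<le> e \<Longrightarrow> S (z - d) = - d"
    using assms by (auto simp: left_translation_def)
  define d where "d = min e z"
  have d: "d > 0" "d \<le> e" "d \<le> z" using e z \<open>z \<noteq> 0\<close> by (auto simp: d_def)
  have "S (z - d) = - d" using e(2) d by simp
  then show False using unit[of "z - d"] d z by auto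
qed

lemma pow_zero_break: "(S ^^ Suc k) x = 0 \<Longrightarrow> (S ^^ k) x \<in> left_breaks S"
  using zero_preimage_break by simp

section \<open>Preimages of breaks and rational step functions\<close>

lemma finite_pre_breaks: "finite (pre_breaks N)"
proof -
  have "{x. \<exists>k\<le>N. (S ^^ k) x \<in> left_breaks S} = (\<Union>k\<le>N. (S ^^ k) -` left_breaks S)" by auto
  then show ?thesis unfolding pre_breaks_def using finite_vimageI[OF fin inj_pow] by simp
qed

lemma pre_breaks_unit: "x \<in> pre_breaks N \<Longrightarrow> 0 < x \<and> x < 1"
proof -
  assume x: "x \<in> pre_breaks N"
  then obtain k where "(S ^^ k) x \<in> left_breaks S" by (auto simp: pre_breaks_def)
  then have "x \<in> {0..<1}" using unit_pow breaks_unit by blast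
  then show ?thesis using x by (auto simp: pre_breaks_def)
qed

lemma pre_breaks_Suc: "pre_breaks N \<subseteq> pre_breaks (Suc N)"
  unfolding pre_breaks_def using le_SucI by blast

lemma breaks_subset_pre_breaks: "left_breaks S \<subseteq> pre_breaks N"
proof
  fix d assume d: "d \<in> left_breaks S"
  then have "(S ^^ 0) d \<in> left_breaks S" "d \<noteq> 0" by (auto simp: left_breaks_def)
  then show "d \<in> pre_breaks N" unfolding pre_breaks_def by blast
qed

lemma preimage_pre_breaks:
  assumes "S w \<in> pre_breaks N" "w \<noteq> 0"
  shows "w \<in> pre_breaks (Suc N)"
proof -
  obtain k where k: "k \<le> N" "(S ^^ k) (S w) \<in> left_breaks S"
    using assms(1) unfolding pre_breaks_def by blast
  have "(S ^^ Suc k) w \<in> left_breaks S"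
    using k(2) by (simp add: funpow_swap1)
  moreover have "Suc k \<le> Suc N" using k(1) by simp
  ultimately show ?thesis using assms(2) unfolding pre_breaks_def by blast
qed

text \<open>The only other obstacle is an iterate equal to \<open>0\<close>, where there is no room
  on the left; but the iterate before it would be a break.\<close>

lemma pow_left_translation:
  assumes "x \<in> {0..<1}" "x \<noteq> 0" "\<And>k. k < n \<Longrightarrow> (S ^^ k) x \<notin> left_breaks S"
  shows "left_translation (S ^^ n) x"
proof (rule left_translation_funpow)
  fix k assume k: "k < n"
  have "(S ^^ k) x \<noteq> 0"
    using assms(2,3) k pow_zero_break[of "k - 1" x] by (cases k) auto
  then show "left_translation S ((S ^^ k) x)"
    using assms(3)[OF k] unit_pow[of k x] assms(1) by (auto simp: left_breaks_def less_le)
qed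

lemma left_breaks_pow: "left_breaks (S ^^ n) \<subseteq> pre_breaks n"
proof
  fix x assume x: "x \<in> left_breaks (S ^^ n)"
  then have x01: "x \<in> {0..<1}" "x \<noteq> 0" by (auto simp: left_breaks_def)
  show "x \<in> pre_breaks n"
  proof (rule ccontr)
    assume "x \<notin> pre_breaks n"
    then have "left_translation (S ^^ n) x"
      using x01 by (intro pow_left_translation) (auto simp: pre_breaks_def)
    then show False using x by (simp add: left_breaks_def)
  qed
qed

text \<open>Level sets of the step function are invariant, so by minimality each contains a point
  left of all jumps, where the value is \<open>0\<close>. Hence the function vanishes, and with it
  every jump.\<close>

lemma invariant_step_function:
  fixes c :: "real \<Rightarrow> rat"
  assumes P: "finite P" "P \<subseteq> {0<..<1}"
    and inv: "\<And>z. z \<in> {0..<1} \<Longrightarrow>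
      (\<Sum>x\<in>P. c x * of_bool (x \<le> S z)) = (\<Sum>x\<in>P. c x * of_bool (x \<le> z))"
    and "x \<in> P"
  shows "c x = 0"
proof (rule ccontr)
  assume cx: "c x \<noteq> 0"
  define f where "f z = (\<Sum>x\<in>P. c x * of_bool (x \<le> z))" for z
  have zero: "f z = 0" if z: "z \<in> {0..<1}" for z
  proof -
    define A where "A = {y \<in> {0..<1}. f y = f z}"
    define b where "b = Min P"
    have "P \<noteq> {}" using \<open>x \<in> P\<close> by blast
    then have b: "b \<in> P" "\<And>x. x \<in> P \<Longrightarrow> b \<le> x" using P(1) by (simp_all add: b_def)
    have "S y \<in> A \<longleftrightarrow> y \<in> A" for y
      using inv[of y] unit[of y] unfolding A_def f_def by auto
    moreover have "z \<in> A" using z by (simp add: A_def)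
    ultimately have "\<exists>y\<in>A. 0 < y \<and> y < b"
      using z b(1) P(2) by (intro minimal[of z A]) auto
    then obtain y where y: "y < b" "f y = f z" by (auto simp: A_def)
    have "f y = 0" unfolding f_def using y(1) b(2) by (intro sum.neutral) force
    then show ?thesis using y(2) by simp
  qed
  define w where "w = Min {x \<in> P. c x \<noteq> 0}"
  have w: "w \<in> P" "c w \<noteq> 0" "\<And>x. x \<in> P \<Longrightarrow> c x \<noteq> 0 \<Longrightarrow> w \<le> x"
    using Min_in[of "{x \<in> P. c x \<noteq> 0}"] cx \<open>x \<in> P\<close> P(1) by (auto simp: w_def)
  \<comment> \<open>At the smallest \<open>w\<close> with nonzero coefficient only its own term
    contributes.\<close>
  have "f w = (\<Sum>x\<in>P. if x = w then c w else 0)"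
    unfolding f_def using w(3) by (intro sum.cong) force+
  then show False using zero[of w] w P by (auto simp: sum.delta')
qed

text \<open>
  The functions \<open>h\<^sub>y = indicator {0..<y}\<close> for \<open>y\<close> in \<open>B\<close> have rationally independent integrals, and
  the coboundaries \<open>f - f \<circ> S\<close> of step functions \<open>f\<close> jumping on \<open>pre_breaks N\<close> have integral \<open>0\<close>
  and vanish only for constant \<open>f\<close>. All of them are step functions jumping on
  \<open>pre_breaks (Suc N)\<close>, so their number is bounded by the dimension of that space.
\<close>

lemma card_independent_le:
  assumes B: "B \<subseteq> insert 1 (pre_breaks (Suc N))" "rat_real.independent B"
  shows "card B + card (pre_breaks N) \<le> card (pre_breaks (Suc N)) + 1"
proof (rule ccontr)
  assume less: "\<not> ?thesis"
  let ?P = "pre_breaks N" and ?Q = "pre_breaks (Suc N)"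
  \<comment> \<open>Step functions jumping on \<open>?Q\<close> are constant from each point of
    \<open>R\<close> to the next, so it is enough to impose vanishing on \<open>R\<close>. These are
    \<open>card ?Q + 1\<close> equations, fewer than the unknowns indexed by
    \<open>A\<close>.\<close>
  define R where "R = insert 0 ?Q"
  define A where "A = ?P <+> B"
  \<comment> \<open>\<open>Inl x\<close> stands for the coboundary of the indicator of
    \<open>[x, 1)\<close>, \<open>Inr y\<close> for the indicator of \<open>[0, y)\<close>.\<close>
  define u :: "real + real \<Rightarrow> real \<Rightarrow> rat" where
    "u a r = (case a of Inl x \<Rightarrow> of_bool (x \<le> r) - of_bool (x \<le> S r)
                      | Inr y \<Rightarrow> of_bool (r < y))" for a r
  have finB: "finite B" using B(1) finite_pre_breaks by (meson finite_insert finite_subset)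
  have finR: "finite R" by (simp add: R_def finite_pre_breaks)
  have "0 \<notin> ?Q" by (simp add: pre_breaks_def)
  then have "card R < card A"
    using less finB finite_pre_breaks by (simp add: R_def A_def card_Plus)
  moreover have "finite A" using finB finite_pre_breaks by (simp add: A_def)
  ultimately obtain c where c: "\<exists>a\<in>A. c a \<noteq> 0" "\<And>r. r \<in> R \<Longrightarrow> (\<Sum>a\<in>A. c a * u a r) = 0"
    using homogeneous_system[OF finR, of A u] by blast
  have vanish: "(\<Sum>a\<in>A. c a * u a z) = 0" if z: "z \<in> {0..<1}" for z
  proof -
    define r where "r = Max {r \<in> R. r \<le> z}"
    have fin': "finite {r \<in> R. r \<le> z}" using finR by simp
    have "{r \<in> R. r \<le> z} \<noteq> {}" using z by (auto simp: R_def)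
    from Max_in[OF fin' this] have r: "r \<in> R" "r \<le> z" by (auto simp: r_def)
    have r0: "0 \<le> r" using r(1) pre_breaks_unit by (force simp: R_def)
    have gap: "x \<le> r \<longleftrightarrow> x \<le> z" if "x \<in> ?Q" for x
    proof
      assume "x \<le> z"
      then show "x \<le> r" using that unfolding r_def by (intro Max_ge[OF fin']) (simp add: R_def)
    qed (use r(2) in simp)
    have shift: "S w - w = S r - r" if "r \<le> w" "w \<le> z" for w
    proof (rule translates_offD[OF transl r0 that(1)])
      show "w < 1" using that z by simp
      show "{r<..w} \<inter> left_breaks S = {}"
        using gap breaks_subset_pre_breaks that by fastforce
    qed
    have Sgap: "x \<le> S r \<longleftrightarrow> x \<le> S z" if x: "x \<in> ?P" for x
    proof
      assume "x \<le> S r"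
      then show "x \<le> S z" using shift[of z] r(2) by simp
    next
      assume le: "x \<le> S z"
      show "x \<le> S r"
      proof (rule ccontr)
        assume gt: "\<not> x \<le> S r"
        \<comment> \<open>If \<open>S\<close> passed \<open>x\<close> between \<open>r\<close> and
          \<open>z\<close>, it would take the value \<open>x\<close> at this \<open>w\<close>, since
          it translates there; then \<open>w\<close> would be a point of \<open>?Q\<close> in
          \<open>(r, z]\<close>.\<close>
        define w where "w = r + (x - S r)"
        have w: "r < w" "w \<le> z" using gt le shift[of z] r(2) by (auto simp: w_def)
        then have "S w = x" using shift[of w] by (simp add: w_def)
        then have "w \<in> ?Q" using preimage_pre_breaks[of w N] x w r0 by auto
        then show False using gap[of w] w by simp
      qed
    qed
    have "u a z = u a r" if "a \<in> A" for a
    proof (cases a)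
      case (Inl x)
      then have x: "x \<in> ?P" using that by (auto simp: A_def)
      then have "x \<in> ?Q" using pre_breaks_Suc by blast
      then show ?thesis using gap[of x] Sgap[OF x] Inl by (simp add: u_def)
    next
      case (Inr y)
      then have "y = 1 \<or> y \<in> ?Q" using that B(1) by (auto simp: A_def)
      then show ?thesis using gap[of y] z r(2) Inr by (auto simp: u_def not_le[symmetric])
    qed
    then have "(\<Sum>a\<in>A. c a * u a z) = (\<Sum>a\<in>A. c a * u a r)" by (intro sum.cong) auto
    then show ?thesis using c(2)[OF r(1)] by simp
  qed
  have vanish': "(\<Sum>x\<in>?P. c (Inl x) * (of_bool (x \<le> z) - of_bool (x \<le> S z))) +
      (\<Sum>y\<in>B. c (Inr y) * of_bool (z < y)) = 0" if z: "z \<in> {0..<1}" for z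
    using vanish[OF z] finB finite_pre_breaks by (simp add: A_def sum.Plus u_def)
  \<comment> \<open>The vanishing combination is integrated as a real function. Coboundaries
    contribute \<open>0\<close> because \<open>S\<close> preserves measure, which leaves a rational
    relation between the elements of \<open>B\<close>.\<close>
  define F :: "real \<Rightarrow> real" where "F t =
      (\<Sum>x\<in>?P. of_rat (c (Inl x)) * (indicator {x..<1} t - indicator {t \<in> {0..<1}. x \<le> S t} t)) +
      (\<Sum>y\<in>B. of_rat (c (Inr y)) * indicator {0..<y} t)" for t
  have B01: "0 < y \<and> y \<le> 1" if "y \<in> B" for y using that B(1) pre_breaks_unit by force
  have P01: "0 < x \<and> x < 1" if "x \<in> ?P" for x using that pre_breaks_unit by blast
  have "has_bochner_integral lborel F
      ((\<Sum>x\<in>?P. of_rat (c (Inl x)) * ((1 - x) - (1 - x))) + (\<Sum>y\<in>B. of_rat (c (Inr y)) * y))"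
    unfolding F_def
  proof (intro has_bochner_integral_add has_bochner_integral_sum has_bochner_integral_mult_right
      has_bochner_integral_diff)
    fix x assume x: "x \<in> ?P"
    show "has_bochner_integral lborel (indicator {x..<1}) (1 - x)"
      using has_bochner_integral_real_indicator[of "{x..<1}" lborel] P01[OF x] by simp
    have "emeasure lborel {t \<in> {0..<1}. x \<le> S t} < \<infinity>"
      by (rule emeasure_bounded_finite) (rule bounded_subset[of "{0..<1}"], auto)
    then show "has_bochner_integral lborel (indicator {t \<in> {0..<1}. x \<le> S t}) (1 - x)"
      using has_bochner_integral_real_indicator[OF sets_pre[of x]] measure_pre[of x] P01[OF x]
      by simp
  next
    fix y assume y: "y \<in> B"
    show "has_bochner_integral lborel (indicator {0..<y}) y"
      using has_bochner_integral_real_indicator[of "{0..<y}" lborel] B01[OF y] by simp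
  qed
  moreover have "F t = 0" for t
  proof (cases "t \<in> {0..<1}")
    case True
    have "F t = of_rat ((\<Sum>x\<in>?P. c (Inl x) * (of_bool (x \<le> t) - of_bool (x \<le> S t))) +
        (\<Sum>y\<in>B. c (Inr y) * of_bool (t < y)))"
      unfolding F_def of_rat_add of_rat_sum of_rat_mult
      using True by (intro arg_cong2[of _ _ _ _ "(+)"] sum.cong refl arg_cong2[of _ _ _ _ "(*)"])
        (auto simp: indicator_def of_rat_diff)
    then show ?thesis using vanish'[OF True] by simp
  next
    case False
    then have "t \<notin> {x..<1}" "t \<notin> {t \<in> {0..<1}. x \<le> S t}" if "x \<in> ?P" for x
      using P01[OF that] by auto
    moreover have "t \<notin> {0..<y}" if "y \<in> B" for y
      using B01[OF that] False by auto
    ultimately show ?thesis unfolding F_def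
      by (simp add: indicator_def del: atLeastLessThan_iff mem_Collect_eq)
  qed
  then have "F = (\<lambda>_. 0)" ..
  ultimately have "(\<Sum>y\<in>B. of_rat (c (Inr y)) * y) = 0"
    using has_bochner_integral_eq[OF _ has_bochner_integral_zero[of lborel]] by simp
  then have "(\<Sum>y\<in>B. rat_scale (c (Inr y)) y) = 0" by (simp add: rat_scale_def)
  then have cB: "c (Inr y) = 0" if "y \<in> B" for y
    using rat_real.independentD[OF B(2) finB order_refl, of "\<lambda>y. c (Inr y)"] that by simp
  \<comment> \<open>With the coefficients on \<open>B\<close> gone, the relation says that the
    remaining step function is invariant under \<open>S\<close>.\<close>
  have cP: "c (Inl x) = 0" if "x \<in> ?P" for x
  proof (rule invariant_step_function[OF finite_pre_breaks[of N] _ _ that])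
    show "?P \<subseteq> {0<..<1}" using P01 by auto
    fix z :: real assume "z \<in> {0..<1}"
    from vanish'[OF this] cB
    show "(\<Sum>x\<in>?P. c (Inl x) * of_bool (x \<le> S z)) = (\<Sum>x\<in>?P. c (Inl x) * of_bool (x \<le> z))"
      by (simp add: right_diff_distrib sum_subtractf)
  qed
  show False using c(1) cB cP by (auto simp: A_def)
qed

section \<open>Counting the orbits of breaks\<close>

lemma pre_breaks_growth: "\<exists>N\<ge>M. card (pre_breaks (Suc N)) \<le> card (pre_breaks N) + card initial_breaks"
proof -
  have "\<forall>d\<in>left_breaks S - initial_breaks. \<exists>k>0. \<exists>e\<in>left_breaks S. (S ^^ k) e = d"
    by (auto simp: initial_breaks_def)
  then obtain h where h: "\<And>d. d \<in> left_breaks S - initial_breaks \<Longrightarrow>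
      h d > 0 \<and> (\<exists>e\<in>left_breaks S. (S ^^ h d) e = d)" by metis
  \<comment> \<open>A non-initial break \<open>d\<close> is reached from some break in
    \<open>h d\<close> steps; the sum merely bounds all these times at once.\<close>
  define N where "N = M + (\<Sum>d\<in>left_breaks S - initial_breaks. h d)"
  have hN: "h d \<le> N" if "d \<in> left_breaks S - initial_breaks" for d
    using member_le_sum[OF that, of h] fin by (simp add: N_def)
  have "pre_breaks (Suc N) - pre_breaks N \<subseteq> inv (S ^^ Suc N) ` initial_breaks"
  proof
    fix x assume x: "x \<in> pre_breaks (Suc N) - pre_breaks N"
    then obtain k where k: "k \<le> Suc N" "(S ^^ k) x \<in> left_breaks S" by (auto simp: pre_breaks_def)
    have no: "(S ^^ j) x \<notin> left_breaks S" if "j \<le> N" for j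
      using x that by (auto simp: pre_breaks_def)
    then have "k = Suc N" using k not_less_eq_eq le_antisym by blast
    then have d: "(S ^^ Suc N) x \<in> left_breaks S" using k by blast
    \<comment> \<open>A new point meets its first break at step \<open>Suc N\<close>. Were that
      break not initial, the choice of \<open>N\<close> would put an earlier break on the orbit
      between \<open>x\<close> and it. So each new point is determined by an initial break.\<close>
    have "(S ^^ Suc N) x \<in> initial_breaks"
    proof (rule ccontr)
      assume ni: "(S ^^ Suc N) x \<notin> initial_breaks"
      define k where "k = h ((S ^^ Suc N) x)"
      obtain e where e: "e \<in> left_breaks S" "(S ^^ k) e = (S ^^ Suc N) x" "k > 0"
        using h[of "(S ^^ Suc N) x"] d ni by (auto simp: k_def)
      have "k \<le> N" using hN[of "(S ^^ Suc N) x"] d ni by (simp add: k_def)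
      then have "(S ^^ Suc N) x = (S ^^ k) ((S ^^ (Suc N - k)) x)"
        using funpow_add[of k "Suc N - k" S] by simp
      then have "e = (S ^^ (Suc N - k)) x" using e(2) inj_pow by (metis injD)
      moreover have "Suc N - k \<le> N" using \<open>k > 0\<close> by simp
      ultimately show False using no e(1) by blast
    qed
    then show "x \<in> inv (S ^^ Suc N) ` initial_breaks"
      using inv_f_f[OF inj_pow, of "Suc N" x] by (metis image_eqI)
  qed
  moreover have fi: "finite initial_breaks" using fin by (simp add: initial_breaks_def)
  ultimately have "card (pre_breaks (Suc N) - pre_breaks N) \<le> card initial_breaks"
    by (meson card_image_le card_mono finite_imageI le_trans)
  moreover have "card (pre_breaks (Suc N)) = card (pre_breaks N) + card (pre_breaks (Suc N) - pre_breaks N)"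
    using card_Diff_subset[OF finite_pre_breaks pre_breaks_Suc, of N]
      card_mono[OF finite_pre_breaks pre_breaks_Suc, of N] by simp
  ultimately show ?thesis by (intro exI[of _ N]) (simp add: N_def)
qed

text \<open>On a common orbit, one of two distinct breaks is reached from the other in a positive
  number of steps, so it is not initial.\<close>

lemma initial_breaks_unique:
  assumes "d \<in> initial_breaks" "d' \<in> initial_breaks" "(S ^^ i) d = (S ^^ j) d'"
  shows "d = d'"
proof -
  have *: "d = d'" if "d \<in> initial_breaks" "d' \<in> initial_breaks" "(S ^^ i) d = (S ^^ j) d'" "i \<le> j"
    for d d' i j
  proof -
    have "(S ^^ j) d' = (S ^^ i) ((S ^^ (j - i)) d')"
      using funpow_add[of i "j - i" S] that(4) by simp
    then have "d = (S ^^ (j - i)) d'" using that(3) inj_pow by (metis injD)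
    moreover have "(S ^^ (j - i)) d' \<noteq> d" if "j - i > 0"
      using that \<open>d \<in> initial_breaks\<close> \<open>d' \<in> initial_breaks\<close>
      unfolding initial_breaks_def by blast
    ultimately show ?thesis by (cases "j - i = 0") auto
  qed
  show ?thesis using *[of d d' i j] *[of d' d j i] assms by (cases "i \<le> j") auto
qed

text \<open>No break precedes \<open>d\<close> on its orbit, so \<open>S ^^ (n - 1)\<close>
  translates to the left of \<open>a\<close>, while the last factor \<open>S\<close> breaks at
  \<open>d\<close>.\<close>

lemma initial_break_pow:
  assumes "d \<in> initial_breaks" "n > 0" "(S ^^ (n - 1)) a = d"
  shows "a \<in> left_breaks (S ^^ n)"
proof -
  have d: "d \<in> left_breaks S" using assms(1) by (simp add: initial_breaks_def)
  have a: "a \<in> {0..<1}" using unit_pow[of "n - 1" a] assms(3) breaks_unit[OF d] by simp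
  have nb: "(S ^^ k) a \<notin> left_breaks S" if "k < n - 1" for k
  proof
    assume "(S ^^ k) a \<in> left_breaks S"
    moreover have "(S ^^ (n - 1 - k)) ((S ^^ k) a) = d"
      using funpow_add[of "n - 1 - k" k S] that assms(3) by simp
    moreover have "n - 1 - k > 0" using that by simp
    ultimately show False using assms(1) by (auto simp: initial_breaks_def)
  qed
  \<comment> \<open>If \<open>a\<close> were \<open>0\<close>, its preimage would be a break
    preceding \<open>d\<close>.\<close>
  have "a \<noteq> 0"
  proof
    assume "a = 0"
    obtain z where z: "S z = a" using pow_surj[of 1 a] by auto
    have "(S ^^ Suc (n - 1)) z = d" using z assms(3) by (simp add: funpow_swap1)
    moreover have "z \<in> left_breaks S" using zero_preimage_break z \<open>a = 0\<close> by simp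
    ultimately show False using assms(1) unfolding initial_breaks_def by blast
  qed
  have "\<not> left_translation (S ^^ n) a"
  proof
    assume "left_translation (S ^^ n) a"
    moreover have "S ^^ n = S \<circ> (S ^^ (n - 1))" using assms(2) funpow.simps(2)[of "n - 1" S] by simp
    ultimately have "left_translation S d"
      using left_translation_outer[of "S ^^ (n - 1)" a S]
        pow_left_translation[OF a \<open>a \<noteq> 0\<close> nb] assms(3) by simp
    then show False using d by (simp add: left_breaks_def)
  qed
  then show ?thesis using a \<open>a \<noteq> 0\<close> by (simp add: left_breaks_def)
qed

text \<open>No break follows \<open>l\<close>, so the remaining factors translate to the left of
  \<open>S l\<close> and cannot repair the break at \<open>l\<close>. At \<open>S l = 0\<close>
  there would be no room on the left for this.\<close>

lemma final_break_pow:
  assumes "l \<in> left_breaks S" "n > 0" "\<And>j. j > 0 \<Longrightarrow> (S ^^ j) l \<notin> left_breaks S" "S l \<noteq> 0"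
  shows "l \<in> left_breaks (S ^^ n)"
proof -
  have "(S ^^ k) (S l) \<notin> left_breaks S" for k
    using assms(3)[of "Suc k"] by (simp add: funpow_swap1)
  moreover have "S l \<in> {0..<1}" using unit breaks_unit[OF assms(1)] by blast
  ultimately have lt: "left_translation (S ^^ (n - 1)) (S l)"
    using assms(4) by (intro pow_left_translation) auto
  have "S ^^ n = (S ^^ (n - 1)) \<circ> S" using assms(2) funpow_Suc_right[of "n - 1" S] by simp
  then have "\<not> left_translation (S ^^ n) l"
    using left_translation_inner[OF inj_pow, of "n - 1" S l] lt assms(1)
    by (auto simp: left_breaks_def)
  then show ?thesis using assms(1) by (simp add: left_breaks_def)
qed

text \<open>Without periodic points the orbit meets each of the finitely many breaks at most once,
  so there is a last time \<open>k\<close>.\<close>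

lemma final_break_ex:
  assumes "d \<in> left_breaks S"
  shows "\<exists>k. (S ^^ k) d \<in> left_breaks S \<and> (\<forall>j>0. (S ^^ (j + k)) d \<notin> left_breaks S)"
proof -
  have "inj (\<lambda>k. (S ^^ k) d)"
  proof (rule linorder_injI)
    fix i j :: nat assume "i < j"
    then have "(S ^^ j) d = (S ^^ i) ((S ^^ (j - i)) d)" using funpow_add[of i "j - i" S] by simp
    moreover have "(S ^^ (j - i)) d \<noteq> d" using aperiodic breaks_unit[OF assms] \<open>i < j\<close> by simp
    ultimately show "(S ^^ i) d \<noteq> (S ^^ j) d" using inj_pow by (metis injD)
  qed
  then have f: "finite {k. (S ^^ k) d \<in> left_breaks S}"
    using finite_vimageI[OF fin] by (simp add: vimage_def)
  have "(S ^^ 0) d \<in> left_breaks S" using assms by simp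
  then have ne: "{k. (S ^^ k) d \<in> left_breaks S} \<noteq> {}" by blast
  define k where "k = Max {k. (S ^^ k) d \<in> left_breaks S}"
  have "(S ^^ k) d \<in> left_breaks S" using Max_in[OF f ne] by (simp add: k_def)
  moreover have "(S ^^ (j + k)) d \<notin> left_breaks S" if "j > 0" for j
    using Max_ge[OF f, of "j + k"] that by (auto simp: k_def)
  ultimately show ?thesis by blast
qed

lemma card_initial_breaks:
  assumes "n \<ge> 2"
  shows "2 * card initial_breaks \<le> card (left_breaks (S ^^ n)) + 1"
proof -
  have sub: "initial_breaks \<subseteq> left_breaks S" by (auto simp: initial_breaks_def)
  then have fi: "finite initial_breaks" using fin finite_subset by blast
  \<comment> \<open>Outside \<open>E0\<close> the last break does not lead to \<open>0\<close>.
    Initial breaks that reach \<open>0\<close> share an orbit, so at most one is lost.\<close>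
  define E0 where "E0 = {d \<in> initial_breaks. \<exists>k. (S ^^ k) d = 0}"
  have "card E0 \<le> Suc 0"
  proof (rule card_le_Suc0_iff_eq[THEN iffD2])
    show "finite E0" using fi by (simp add: E0_def)
    show "\<forall>d\<in>E0. \<forall>d'\<in>E0. d = d'"
    proof (intro ballI)
      fix d d' assume "d \<in> E0" "d' \<in> E0"
      then obtain i j where "d \<in> initial_breaks" "d' \<in> initial_breaks" "(S ^^ i) d = 0" "(S ^^ j) d' = 0"
        by (auto simp: E0_def)
      then show "d = d'" using initial_breaks_unique[of d d' i j] by simp
    qed
  qed
  have "\<forall>d\<in>initial_breaks. \<exists>k. (S ^^ k) d \<in> left_breaks S \<and> (\<forall>j>0. (S ^^ (j + k)) d \<notin> left_breaks S)"
    using final_break_ex sub by blast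
  then obtain h where h: "\<And>d. d \<in> initial_breaks \<Longrightarrow> (S ^^ h d) d \<in> left_breaks S"
    "\<And>d j. d \<in> initial_breaks \<Longrightarrow> j > 0 \<Longrightarrow> (S ^^ (j + h d)) d \<notin> left_breaks S" by metis
  define a where "a d = inv (S ^^ (n - 1)) d" for d
  define l where "l d = (S ^^ h d) d" for d
  have a: "(S ^^ (n - 1)) (a d) = d" for d
    unfolding a_def using bij_fn[OF bij, of "n - 1"] by (metis bij_inv_eq_iff)
  have aT: "a d \<in> left_breaks (S ^^ n)" if "d \<in> initial_breaks" for d
    using initial_break_pow[OF that _ a] assms by simp
  have lT: "l d \<in> left_breaks (S ^^ n)" if d: "d \<in> initial_breaks - E0" for d
  proof (rule final_break_pow)
    show "l d \<in> left_breaks S" using h(1) d by (simp add: l_def)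
    show "(S ^^ j) (l d) \<notin> left_breaks S" if "j > 0" for j
      using h(2)[of d j] d that by (simp add: l_def funpow_add)
    have "(S ^^ Suc (h d)) d \<noteq> 0" using d unfolding E0_def by blast
    then show "S (l d) \<noteq> 0" by (simp add: l_def)
  qed (use assms in simp)
  have "inj_on a initial_breaks" using a by (metis inj_onI)
  moreover have "inj_on l (initial_breaks - E0)"
    using initial_breaks_unique unfolding l_def by (intro inj_onI) blast
  moreover have "a ` initial_breaks \<inter> l ` (initial_breaks - E0) = {}"
  proof (rule ccontr)
    assume "a ` initial_breaks \<inter> l ` (initial_breaks - E0) \<noteq> {}"
    then obtain d d' where d: "d \<in> initial_breaks" "d' \<in> initial_breaks" "a d = l d'" by blast
    \<comment> \<open>Here \<open>n \<ge> 2\<close> matters: the equality would place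
      \<open>d\<close> strictly after \<open>d'\<close>, whereas for \<open>n = 1\<close> an orbit
      with a single break gives the same point twice.\<close>
    have "n - 1 + h d' > 0" using assms by simp
    moreover have "d' \<in> left_breaks S" using sub d(2) by blast
    ultimately have "(S ^^ (n - 1 + h d')) d' \<noteq> d"
      by (rule initial_breaksD[OF d(1)])
    then show False using a[of d] d(3) by (simp add: l_def funpow_add)
  qed
  ultimately have "card (a ` initial_breaks \<union> l ` (initial_breaks - E0)) =
      card initial_breaks + card (initial_breaks - E0)"
    using fi by (simp add: card_Un_disjoint card_image)
  moreover have "a ` initial_breaks \<union> l ` (initial_breaks - E0) \<subseteq> left_breaks (S ^^ n)"
    using aT lT by blast
  moreover have "finite (left_breaks (S ^^ n))"
    using left_breaks_pow finite_pre_breaks finite_subset by blast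
  ultimately have "card initial_breaks + card (initial_breaks - E0) \<le> card (left_breaks (S ^^ n))"
    by (metis card_mono)
  moreover have "card initial_breaks \<le> card (initial_breaks - E0) + 1"
    using diff_card_le_card_Diff[of E0 initial_breaks] fi \<open>card E0 \<le> Suc 0\<close>
    by (auto simp: E0_def)
  ultimately show ?thesis by simp
qed

lemma independent_bound:
  assumes "n \<ge> 2"
  obtains B where "finite B" "card B \<le> 1 + (card (left_breaks (S ^^ n)) + 1) div 2"
    "insert 1 (left_breaks (S ^^ n)) \<subseteq> rat_real.span B"
proof -
  obtain N where N: "N \<ge> n" "card (pre_breaks (Suc N)) \<le> card (pre_breaks N) + card initial_breaks"
    using pre_breaks_growth by blast
  obtain B where B: "B \<subseteq> insert 1 (pre_breaks (Suc N))" "rat_real.independent B"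
    "insert 1 (pre_breaks (Suc N)) \<subseteq> rat_real.span B"
    using rat_real.maximal_independent_subset by metis
  have "pre_breaks n \<subseteq> pre_breaks (Suc N)"
    unfolding pre_breaks_def using N(1) le_trans by (fastforce simp: le_SucI)
  then have "insert 1 (left_breaks (S ^^ n)) \<subseteq> rat_real.span B"
    using left_breaks_pow[of n] B(3) by blast
  moreover have "finite B" using B(1) finite_pre_breaks by (meson finite_insert finite_subset)
  \<comment> \<open>With \<open>p = card initial_breaks\<close>, the step function count gives
    \<open>card B \<le> 1 + p\<close>, and \<open>2 * p\<close> is at most the number of breaks of
    \<open>S ^^ n\<close> plus one.\<close>
  moreover have "card B \<le> 1 + (card (left_breaks (S ^^ n)) + 1) div 2"
    using card_independent_le[OF B(1,2)] N(2) card_initial_breaks[OF assms] by linarith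
  ultimately show ?thesis using that by blast
qed

end

section \<open>Minimality of roots and the bound on the rank\<close>

lemma minimal_exchange_root:
  assumes "iet_data m \<pi> lam" "S = iet m \<pi> lam" "minimal_iet (S ^^ n)"
  shows "minimal_exchange S"
proof
  show "bij S" using bij_iet assms by simp
  show "S x \<in> {0..<1} \<longleftrightarrow> x \<in> {0..<1}" for x using iet_in_unit assms by simp
  let ?B = "iet_beta lam ` {1..m - 1}"
  have off: "translates_off S ?B" using iet_translates_off assms by simp
  show "finite (left_breaks S)"
    using left_breaks_subset[OF _ off] finite_subset by blast
  show "translates_off S (left_breaks S)"
    using translates_off_left_breaks[OF _ off] by simp
  show "{t \<in> {0..<1}. x \<le> S t} \<in> sets lborel"
    "measure lborel {t \<in> {0..<1}. x \<le> S t} = 1 - x" if "0 \<le> x" "x \<le> 1" for x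
    using iet_measure_preserving[OF assms(1) that] assms(2) by auto
  fix x a b :: real and A
  assume x: "x \<in> {0..<1}" "x \<in> A" and inv: "\<And>y. S y \<in> A \<longleftrightarrow> y \<in> A"
    and ab: "0 \<le> a" "a < b" "b \<le> 1"
  \<comment> \<open>A set invariant under \<open>S\<close> is invariant under \<open>S ^^ n\<close>
    and its inverse, so it contains a whole orbit of \<open>S ^^ n\<close>, which is dense.\<close>
  have pow: "(S ^^ k) y \<in> A \<longleftrightarrow> y \<in> A" for k y by (induction k) (use inv in auto)
  have powT: "((S ^^ n) ^^ k) y \<in> A \<longleftrightarrow> y \<in> A" for k y
    using pow[of "k * n"] by (simp add: funpow_mult mult.commute)
  have bijT: "bij (S ^^ n)" using \<open>bij S\<close> by (rule bij_fn)
  have "(inv (S ^^ n) ^^ k) y \<in> A \<longleftrightarrow> y \<in> A" for k y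
  proof (induction k)
    case (Suc k)
    have "(S ^^ n) (inv (S ^^ n) w) = w" for w using bijT by (meson bij_inv_eq_iff)
    then have "inv (S ^^ n) w \<in> A \<longleftrightarrow> w \<in> A" for w using pow[of n "inv (S ^^ n) w"] by simp
    then show ?case using Suc by simp
  qed simp
  then have orb: "int_iterate (S ^^ n) k x \<in> A" for k
    using powT x(2) by (simp add: int_iterate_def)
  have "(a + b) / 2 \<in> {0..<1}" using ab by auto
  then have "(a + b) / 2 \<in> closure {int_iterate (S ^^ n) k x | k. True}"
    using assms(3) x(1) unfolding minimal_iet_def by blast
  moreover have "open {a<..<b}" "(a + b) / 2 \<in> {a<..<b}" using ab by auto
  ultimately have "{a<..<b} \<inter> {int_iterate (S ^^ n) k x | k. True} \<noteq> {}"
    using open_Int_closure_eq_empty by blast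
  then show "\<exists>y\<in>A. a < y \<and> y < b" using orb by auto
qed

lemma gap_lengths_subset_span:
  assumes "finite (discontinuities T)" "insert 1 (discontinuities T) \<subseteq> rat_real.span B"
  shows "gap_lengths T \<subseteq> rat_real.span B"
proof
  fix g assume "g \<in> gap_lengths T"
  then obtain j where j: "g = break_points T ! j - break_points T ! (j - 1)" "j < length (break_points T)"
    by (auto simp: gap_lengths_def)
  have "set (break_points T) = {0, 1} \<union> discontinuities T"
    unfolding break_points_def using assms(1) by (intro set_sorted_list_of_set) simp
  then have "set (break_points T) \<subseteq> rat_real.span B"
    using assms(2) rat_real.span_zero by auto
  moreover have "break_points T ! j \<in> set (break_points T)" "break_points T ! (j - 1) \<in> set (break_points T)"
    using j(2) by auto
  ultimately show "g \<in> rat_real.span B" unfolding j(1) by (intro rat_real.span_diff) auto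
qed

theorem theorem2p4:
  fixes m :: nat and \<pi> :: "nat \<Rightarrow> nat" and lam :: "nat \<Rightarrow> real" and T :: "real \<Rightarrow> real"
  assumes "iet_data m \<pi> lam"
    and "T = iet m \<pi> lam"
    and "separating m \<pi>"
    and "minimal_iet T"
    and "\<exists>n\<ge>2. has_iet_root n T"
  shows "iet_rank T \<le> 1 + m div 2"
proof -
  obtain n S where n: "n \<ge> 2" and S: "S \<in> IETs" "T = S ^^ n"
    using assms(5) by (auto simp: has_iet_root_def)
  interpret minimal_exchange S
    using S assms(4) minimal_exchange_root by (auto simp: IETs_def)
  let ?C = "iet_beta lam ` {1..m - 1}"
  have off: "translates_off T ?C" using iet_translates_off assms(1,2) by simp
  \<comment> \<open>Only the \<open>m - 1\<close> inner endpoints can be breaks; the extra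
    \<open>1\<close> due to the orbit of \<open>0\<close> brings the count to at most
    \<open>m\<close>.\<close>
  have "card (left_breaks T) \<le> card {1..m - 1}"
    using left_breaks_subset[OF _ off] by (meson card_image_le card_mono finite_atLeastAtMost
      finite_imageI le_trans)
  moreover have "m \<ge> 1" using assms(1) by (simp add: iet_data_def)
  ultimately have "card (left_breaks T) + 1 \<le> m" by simp
  then have le: "(card (left_breaks T) + 1) div 2 \<le> m div 2" by (rule div_le_mono)
  obtain B where B: "finite B" "card B \<le> 1 + (card (left_breaks T) + 1) div 2"
    "insert 1 (left_breaks T) \<subseteq> rat_real.span B"
    using independent_bound[OF n] S(2) by metis
  have "discontinuities T \<subseteq> left_breaks T"
    using discontinuities_subset_left_breaks[OF _ off] by simp
  moreover from this have "finite (discontinuities T)"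
    using left_breaks_subset[OF _ off] by (meson finite_atLeastAtMost finite_imageI finite_subset)
  ultimately have "gap_lengths T \<subseteq> rat_real.span B"
    using B(3) by (intro gap_lengths_subset_span) auto
  then have "rat_real.span (gap_lengths T) \<subseteq> rat_real.span B"
    using rat_real.span_minimal rat_real.subspace_span by blast
  then have "iet_rank T \<le> card B"
    unfolding iet_rank_def using B(1) by (intro rat_real.dim_le_card) auto
  then show ?thesis using B(2) le by linarith
qed

end
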